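(* Let $k\ge 1$, let $\Sigma$ be a Borel probability measure on the set of $k\times k$ column-stochastic matrices, and let $S_1,S_2,\dots$ be i.i.d. random matrices with law $\Sigma$. For each $n\ge 1$ let $X^{[n]}$ be the EFCP chain on $[k]^{[n]}$ with paintbox measure $\Sigma$. Assume that for some $m\ge 1$ there is positive probability that all entries of the matrix product $S_mS_{m-1}\cdots S_1$ are nonzero. Then for every $n\ge1$ the chain $X^{[n]}$ is ergodic, and it mixes in $O(\log n)$ steps: for every $\varepsilon\in(0,1)$, $t^{(n)}_{\mathrm{mix}}(\varepsilon)=O(\log n)$ as $n\to\infty$.
   Context: Notation: $[k]=\{1,\dots,k\}$; elements of $[k]^{[n]}$ are written $x=x^1x^2\cdots x^n$. A $k\times k$ matrix $S$ is column-stochastic if its entries are nonnegative and each column sums to $1$; $S(a,b)$ denotes the entry in row $a$, column $b$. The EFCP (exchangeable Feller cut-and-paste) chain on $[k]^{[n]}$ with paintbox measure $\Sigma$ is the time-homogeneous Markov chain with transition probabilities $P(x,y)=\int \prod_{i=1}^n S(y^i,x^i)\,\Sigma(dS)$; that is, at each step $m$ a fresh matrix $S_m\sim\Sigma$ is drawn (independently of the past) and, given $S_m$ and the current state $x$, the coordinates of the next state are independent, the $i$-th having distribution given by column $x^i$ of $S_m$. "Ergodic" means that the chain has a unique stationary distribution. With $\pi^{(n)}$ the unique stationary distribution and $\mathcal D(X_m)$ the law of the chain at time $m$, the mixing time is $t^{(n)}_{\mathrm{mix}}(\varepsilon)=\min\{m\ge 1:\max_{x_0}\|\mathcal D(X_m)-\pi^{(n)}\|_{TV}<\varepsilon\}$,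 where the maximum is over initial states $X_0=x_0\in[k]^{[n]}$ and $\|\mu-\nu\|_{TV}=\frac12\sum_x|\mu(x)-\nu(x)|$. *)

theory Defs
  imports "HOL-Probability.Probability"
begin

(* Matrices are indexed by a finite type 'k standing for {1,...,k}; S $ a $ b is the
   entry in row a and column b. *)

definition column_stochastic :: "real^'k^'k \<Rightarrow> bool" where
  "column_stochastic S \<longleftrightarrow>
     (\<forall>a b. 0 \<le> S $ a $ b) \<and> (\<forall>b. (\<Sum>a\<in>UNIV. S $ a $ b) = 1)"

definition paintbox_measure :: "(real^'k^'k) measure \<Rightarrow> bool" where
  "paintbox_measure \<mu> \<longleftrightarrow>
     prob_space \<mu> \<and> sets \<mu> = sets (restrict_space borel {S. column_stochastic S})"

text \<open>The state space: functions from \<open>{1..n}\<close> to \<open>'k\<close>, set to \<open>undefined\<close> outside \<open>{1..n}\<close>.\<close>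

definition states :: "nat \<Rightarrow> (nat \<Rightarrow> 'k) set" where
  "states n = {1..n} \<rightarrow>\<^sub>E UNIV"

definition transition_prob ::
    "(real^'k^'k) measure \<Rightarrow> nat \<Rightarrow> (nat \<Rightarrow> 'k) \<Rightarrow> (nat \<Rightarrow> 'k) \<Rightarrow> real" where
  "transition_prob \<mu> n x y = (\<integral>S. (\<Prod>i\<in>{1..n}. S $ y i $ x i) \<partial>\<mu>)"

text \<open>\<open>embed_pmf\<close> is meaningful only for nonnegative weights of total mass 1; that this is
  the case for paintbox measures is shown by \<open>pmf_kernel\<close> below.\<close>

definition kernel :: "(real^'k^'k) measure \<Rightarrow> nat \<Rightarrow> (nat \<Rightarrow> 'k) \<Rightarrow> (nat \<Rightarrow> 'k) pmf" where
  "kernel \<mu> n x = embed_pmf (\<lambda>y. if y \<in> states n then transition_prob \<mu> n x y else 0)"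

primrec chain_law ::
    "(real^'k^'k) measure \<Rightarrow> nat \<Rightarrow> (nat \<Rightarrow> 'k) \<Rightarrow> nat \<Rightarrow> (nat \<Rightarrow> 'k) pmf" where
  "chain_law \<mu> n x0 0 = return_pmf x0"
| "chain_law \<mu> n x0 (Suc m) = bind_pmf (chain_law \<mu> n x0 m) (kernel \<mu> n)"

definition stationary :: "(real^'k^'k) measure \<Rightarrow> nat \<Rightarrow> (nat \<Rightarrow> 'k) pmf \<Rightarrow> bool" where
  "stationary \<mu> n \<pi> \<longleftrightarrow> set_pmf \<pi> \<subseteq> states n \<and> bind_pmf \<pi> (kernel \<mu> n) = \<pi>"

definition ergodic :: "(real^'k^'k) measure \<Rightarrow> nat \<Rightarrow> bool" where
  "ergodic \<mu> n \<longleftrightarrow> (\<exists>!\<pi>. stationary \<mu> n \<pi>)"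

definition stationary_law :: "(real^'k^'k) measure \<Rightarrow> nat \<Rightarrow> (nat \<Rightarrow> 'k) pmf" where
  "stationary_law \<mu> n = (THE \<pi>. stationary \<mu> n \<pi>)"

definition tv_dist :: "nat \<Rightarrow> (nat \<Rightarrow> 'k) pmf \<Rightarrow> (nat \<Rightarrow> 'k) pmf \<Rightarrow> real" where
  "tv_dist n p q = (1/2) * (\<Sum>x\<in>states n. \<bar>pmf p x - pmf q x\<bar>)"

definition mixed_at :: "(real^'k^'k) measure \<Rightarrow> nat \<Rightarrow> real \<Rightarrow> nat \<Rightarrow> bool" where
  "mixed_at \<mu> n \<epsilon> m \<longleftrightarrow>
     (MAX x0\<in>states n. tv_dist n (chain_law \<mu> n x0 m) (stationary_law \<mu> n)) < \<epsilon>"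

text \<open>An unspecified number if the chain never mixes to within \<open>\<epsilon>\<close>; statements about
  \<open>mixing_time\<close> should therefore also assert that such a time exists.\<close>

definition mixing_time :: "(real^'k^'k) measure \<Rightarrow> nat \<Rightarrow> real \<Rightarrow> nat" where
  "mixing_time \<mu> n \<epsilon> = (LEAST m. 1 \<le> m \<and> mixed_at \<mu> n \<epsilon> m)"

text \<open>\<open>left_prod A m\<close> is the product \<open>A m ** \<dots> ** A 1\<close>.\<close>

primrec left_prod :: "(nat \<Rightarrow> real^'k^'k) \<Rightarrow> nat \<Rightarrow> real^'k^'k" where
  "left_prod A 0 = mat 1"
| "left_prod A (Suc m) = A (Suc m) ** left_prod A m"


lemma finite_states: "finite (states n :: (nat \<Rightarrow> 'k::finite) set)"
  unfolding states_def by (intro finite_PiE) auto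

lemma column_stochastic_le_1:
  assumes "column_stochastic (S :: real^'k::finite^'k)"
  shows "S $ a $ b \<le> 1"
proof -
  have "S $ a $ b \<le> (\<Sum>a\<in>UNIV. S $ a $ b)"
    using assms by (intro member_le_sum) (auto simp: column_stochastic_def)
  then show ?thesis
    using assms by (simp add: column_stochastic_def)
qed

lemma paintbox_space:
  assumes "paintbox_measure \<mu>"
  shows "space \<mu> = {S. column_stochastic S}"
  using sets_eq_imp_space_eq[of \<mu> "restrict_space borel {S. column_stochastic S}"] assms
  by (simp add: paintbox_measure_def space_restrict_space)

lemma measurable_entry:
  assumes "paintbox_measure \<mu>"
  shows "(\<lambda>S::real^'k::finite^'k. S $ a $ b) \<in> borel_measurable \<mu>"
proof -
  have "(\<lambda>S::real^'k^'k. S $ a $ b) \<in> borel_measurable borel"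
    by (intro borel_measurable_continuous_onI continuous_intros)
  then have "(\<lambda>S::real^'k^'k. S $ a $ b)
      \<in> borel_measurable (restrict_space borel {S. column_stochastic S})"
    by (rule measurable_restrict_space1)
  then show ?thesis
    using assms measurable_cong_sets by (metis paintbox_measure_def)
qed

lemma integrable_entries:
  assumes "paintbox_measure \<mu>"
  shows "integrable \<mu> (\<lambda>S::real^'k::finite^'k. \<Prod>i\<in>{1..n}. S $ y i $ x i)"
proof -
  interpret prob_space \<mu> using assms by (simp add: paintbox_measure_def)
  show ?thesis
  proof (rule integrable_const_bound[where B=1])
    show "AE S in \<mu>. norm (\<Prod>i\<in>{1..n}. S $ y i $ x i) \<le> 1"
    proof (rule AE_I2)
      fix S assume "S \<in> space \<mu>"
      then have S: "column_stochastic S" using paintbox_space[OF assms] by simp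
      then have "0 \<le> S $ a $ b" for a b by (simp add: column_stochastic_def)
      then show "norm (\<Prod>i\<in>{1..n}. S $ y i $ x i) \<le> 1"
        using column_stochastic_le_1[OF S] by (simp add: prod_nonneg prod_le_1)
    qed
  qed (intro borel_measurable_prod measurable_entry assms)
qed

lemma transition_prob_nonneg:
  assumes "paintbox_measure (\<mu> :: (real^'k::finite^'k) measure)"
  shows "0 \<le> transition_prob \<mu> n x y"
  unfolding transition_prob_def
  by (rule integral_nonneg_AE, rule AE_I2)
     (auto simp: paintbox_space[OF assms] column_stochastic_def intro!: prod_nonneg)

lemma sum_transition_prob:
  assumes "paintbox_measure (\<mu> :: (real^'k::finite^'k) measure)"
  shows "(\<Sum>y\<in>states n. transition_prob \<mu> n x y) = 1"
proof -
  interpret prob_space \<mu> using assms by (simp add: paintbox_measure_def)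
  have "(\<Sum>y\<in>states n. transition_prob \<mu> n x y)
      = (\<integral>S. (\<Sum>y\<in>states n. \<Prod>i\<in>{1..n}. S $ y i $ x i) \<partial>\<mu>)"
    unfolding transition_prob_def
    by (rule Bochner_Integration.integral_sum[symmetric], rule integrable_entries[OF assms])
  also have "\<dots> = (\<integral>S. 1 \<partial>\<mu>)"
  proof (rule Bochner_Integration.integral_cong)
    fix S assume "S \<in> space \<mu>"
    then have S: "column_stochastic S" using paintbox_space[OF assms] by simp
    have "(\<Sum>y\<in>states n. \<Prod>i\<in>{1..n}. S $ y i $ x i) = (\<Prod>i\<in>{1..n}. \<Sum>a\<in>UNIV. S $ a $ x i)"
      unfolding states_def by (subst prod_sum_PiE) auto
    then show "(\<Sum>y\<in>states n. \<Prod>i\<in>{1..n}. S $ y i $ x i) = 1"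
      using S by (simp add: column_stochastic_def)
  qed simp
  finally show ?thesis by (simp add: prob_space)
qed

lemma pmf_kernel:
  assumes "paintbox_measure (\<mu> :: (real^'k::finite^'k) measure)"
  shows "pmf (kernel \<mu> n x) y = (if y \<in> states n then transition_prob \<mu> n x y else 0)"
  unfolding kernel_def
proof (rule pmf_embed_pmf)
  let ?f = "\<lambda>y. if y \<in> states n then transition_prob \<mu> n x y else 0"
  show "0 \<le> ?f y" for y using transition_prob_nonneg[OF assms] by simp
  have "(\<integral>\<^sup>+y. ennreal (?f y) \<partial>count_space UNIV)
      = (\<integral>\<^sup>+y. ennreal (transition_prob \<mu> n x y) \<partial>count_space (states n))"
    by (subst nn_integral_count_space_indicator)
       (auto intro!: nn_integral_cong simp: indicator_def)
  also have "\<dots> = ennreal (\<Sum>y\<in>states n. transition_prob \<mu> n x y)"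
    by (simp add: nn_integral_count_space_finite finite_states sum_ennreal
        transition_prob_nonneg[OF assms])
  finally show "(\<integral>\<^sup>+y. ennreal (?f y) \<partial>count_space UNIV) = 1"
    by (simp add: sum_transition_prob[OF assms])
qed

end

theory Submission
  imports Defs
begin

text \<open>Write \<open>Q\<^sub>t = S\<^sub>t \<cdots> S\<^sub>1\<close>. The law of the chain at time \<open>t\<close> started from \<open>x\<close> is
  \<open>E (\<Prod>i. Q\<^sub>t(y\<^sup>i, x\<^sup>i))\<close>, so two starting points are at total variation distance at most
  \<open>n \<cdot> E D(Q\<^sub>t)\<close>, where \<open>D\<close> sums the \<open>L\<^sup>1\<close> distances between columns. If all entries of a
  stochastic matrix \<open>A\<close> are at least \<open>\<delta>\<close>, then \<open>D(A B) \<le> (1 - k \<delta>) D(B)\<close>. By independence of disjoint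
  blocks of \<open>m\<close> matrices, \<open>E D(Q\<^bsub>mj\<^esub>)\<close> decays like \<open>r\<^sup>j\<close> with \<open>r < 1\<close> not depending on \<open>n\<close>, and
  \<open>n r\<^sup>j\<close> is small as soon as \<open>j\<close> is a large multiple of \<open>ln n\<close>. The same bound makes the laws of the
  chain Cauchy in time, which gives the stationary law and its uniqueness.\<close>

section \<open>Products of column-stochastic matrices and contraction of the distances between
  columns\<close>

lemma left_prod_cong:
  "(\<And>i. 1 \<le> i \<Longrightarrow> i \<le> t \<Longrightarrow> A i = B i) \<Longrightarrow> left_prod A t = left_prod B t"
  by (induction t) simp_all

lemma left_prod_add:
  "left_prod A (s + t) = left_prod (\<lambda>i. A (s + i)) t ** left_prod A s"
  by (induction t) (simp_all add: matrix_mul_assoc)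

lemma column_stochastic_mat_1: "column_stochastic (mat 1 :: real^'k::finite^'k)"
  by (simp add: column_stochastic_def mat_def sum.delta)

lemma column_stochastic_mult:
  fixes A B :: "real^'k::finite^'k"
  assumes A: "column_stochastic A" and B: "column_stochastic B"
  shows "column_stochastic (A ** B)"
proof -
  have "(\<Sum>a\<in>UNIV. (A ** B) $ a $ b) = 1" for b
  proof -
    have "(\<Sum>a\<in>UNIV. (A ** B) $ a $ b) = (\<Sum>a\<in>UNIV. \<Sum>j\<in>UNIV. A $ a $ j * B $ j $ b)"
      by (simp add: matrix_matrix_mult_def)
    also have "\<dots> = (\<Sum>j\<in>UNIV. (\<Sum>a\<in>UNIV. A $ a $ j) * B $ j $ b)"
      by (subst sum.swap) (simp add: sum_distrib_right)
    also have "\<dots> = 1"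
      using A B by (simp add: column_stochastic_def)
    finally show ?thesis .
  qed
  moreover have "0 \<le> (A ** B) $ a $ b" for a b
    using A B by (auto simp: matrix_matrix_mult_def column_stochastic_def intro!: sum_nonneg)
  ultimately show ?thesis
    by (simp add: column_stochastic_def)
qed

lemma column_stochastic_left_prod:
  "(\<And>i. 1 \<le> i \<Longrightarrow> i \<le> t \<Longrightarrow> column_stochastic (A i)) \<Longrightarrow> column_stochastic (left_prod A t)"
  by (induction t) (auto intro: column_stochastic_mult column_stochastic_mat_1)

(* A smooth lower bound for the smallest entry. *)
definition entry_prod :: "real^'k^'k \<Rightarrow> real" where
  "entry_prod A = (\<Prod>a\<in>UNIV. \<Prod>b\<in>UNIV. A $ a $ b)"

text \<open>A sum over all pairs of columns, not a maximum: this makes it visibly continuous in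
  \<open>A\<close>, hence Borel, and it still dominates every single pair.\<close>

definition column_spread :: "real^'k^'k \<Rightarrow> real" where
  "column_spread A = (\<Sum>a\<in>UNIV. \<Sum>b\<in>UNIV. \<Sum>c\<in>UNIV. \<bar>A $ c $ a - A $ c $ b\<bar>)"

lemma column_spread_nonneg: "0 \<le> column_spread A"
  by (simp add: column_spread_def sum_nonneg)

lemma columns_diff_le_column_spread:
  "(\<Sum>c\<in>UNIV. \<bar>A $ c $ a - A $ c $ b\<bar>) \<le> column_spread (A :: real^'k::finite^'k)"
proof -
  have "(\<Sum>c\<in>UNIV. \<bar>A $ c $ a - A $ c $ b\<bar>) \<le> (\<Sum>b\<in>UNIV. \<Sum>c\<in>UNIV. \<bar>A $ c $ a - A $ c $ b\<bar>)"
    by (rule member_le_sum) (auto intro: sum_nonneg)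
  also have "\<dots> \<le> column_spread A"
    unfolding column_spread_def by (rule member_le_sum) (auto intro: sum_nonneg)
  finally show ?thesis .
qed

lemma entry_prod_nonneg: "column_stochastic A \<Longrightarrow> 0 \<le> entry_prod A"
  by (simp add: entry_prod_def column_stochastic_def prod_nonneg)

text \<open>All entries lie in [0,1], so dropping factors from the product can only increase it;
  first the other rows are dropped, then the other entries of row \<open>a\<close>.\<close>

lemma entry_prod_le:
  fixes A :: "real^'k::finite^'k"
  assumes A: "column_stochastic A"
  shows "entry_prod A \<le> A $ a $ b"
proof -
  have *: "0 \<le> A $ a $ b" "A $ a $ b \<le> 1" for a b
    using A column_stochastic_le_1[OF A] by (auto simp: column_stochastic_def)
  have row: "(\<Prod>b\<in>UNIV. A $ a $ b) \<le> 1" for a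
    using * by (intro prod_le_1) auto
  have "entry_prod A = (\<Prod>b\<in>UNIV. A $ a $ b) * (\<Prod>a\<in>UNIV - {a}. \<Prod>b\<in>UNIV. A $ a $ b)"
    by (simp add: entry_prod_def prod.remove[where x=a])
  also have "\<dots> \<le> (\<Prod>b\<in>UNIV. A $ a $ b)"
    using * row by (intro mult_right_le_one_le prod_nonneg prod_le_1) (auto simp: prod_nonneg)
  also have "\<dots> = A $ a $ b * (\<Prod>b\<in>UNIV - {b}. A $ a $ b)"
    by (simp add: prod.remove[where x=b])
  also have "\<dots> \<le> A $ a $ b"
    using * by (intro mult_right_le_one_le prod_nonneg prod_le_1) auto
  finally show ?thesis .
qed

text \<open>Each entry of a column is at least \<open>entry_prod A\<close> and the column sums to 1.
  This keeps the contraction factor \<open>1 - CARD('k) * entry_prod A\<close> in [0,1].\<close>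

lemma entry_prod_card_le_1:
  fixes A :: "real^'k::finite^'k"
  assumes A: "column_stochastic A"
  shows "real CARD('k) * entry_prod A \<le> 1"
proof -
  have "real CARD('k) * entry_prod A = (\<Sum>a\<in>(UNIV::'k set). entry_prod A)"
    by simp
  also have "\<dots> \<le> (\<Sum>a\<in>UNIV. A $ a $ b)" for b
    by (intro sum_mono entry_prod_le A)
  finally show ?thesis
    using A by (simp add: column_stochastic_def)
qed

(* Doeblin minorization: differences of columns have total mass 0, so the constant entry_prod A
   may be subtracted from every entry of A before taking absolute values. *)
lemma column_spread_mult:
  fixes A B :: "real^'k::finite^'k"
  assumes A: "column_stochastic A" and B: "column_stochastic B"
  shows "column_spread (A ** B) \<le> (1 - real CARD('k) * entry_prod A) * column_spread B"
proof -
  let ?d = "entry_prod A"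
  have *: "(\<Sum>c\<in>UNIV. \<bar>(A ** B) $ c $ a - (A ** B) $ c $ b\<bar>)
      \<le> (1 - real CARD('k) * ?d) * (\<Sum>c\<in>UNIV. \<bar>B $ c $ a - B $ c $ b\<bar>)" for a b
  proof -
    let ?v = "\<lambda>j. B $ j $ a - B $ j $ b"
    have v0: "(\<Sum>j\<in>UNIV. ?v j) = 0"
      using B by (simp add: column_stochastic_def sum_subtractf)
    have "\<bar>(A ** B) $ c $ a - (A ** B) $ c $ b\<bar> \<le> (\<Sum>j\<in>UNIV. (A $ c $ j - ?d) * \<bar>?v j\<bar>)" for c
    proof -
      have "(\<Sum>j\<in>UNIV. (A $ c $ j - ?d) * ?v j)
          = (\<Sum>j\<in>UNIV. A $ c $ j * ?v j) - ?d * (\<Sum>j\<in>UNIV. ?v j)"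
        by (subst sum_distrib_left) (simp only: left_diff_distrib sum_subtractf)
      also have "\<dots> = (A ** B) $ c $ a - (A ** B) $ c $ b"
        unfolding v0 by (simp add: matrix_matrix_mult_def right_diff_distrib sum_subtractf)
      finally have "\<bar>(A ** B) $ c $ a - (A ** B) $ c $ b\<bar> = \<bar>\<Sum>j\<in>UNIV. (A $ c $ j - ?d) * ?v j\<bar>"
        by simp
      also have "\<dots> \<le> (\<Sum>j\<in>UNIV. \<bar>(A $ c $ j - ?d) * ?v j\<bar>)"
        by (rule sum_abs)
      also have "\<dots> = (\<Sum>j\<in>UNIV. (A $ c $ j - ?d) * \<bar>?v j\<bar>)"
        using entry_prod_le[OF A] by (simp add: abs_mult)
      finally show ?thesis .
    qed
    then have "(\<Sum>c\<in>UNIV. \<bar>(A ** B) $ c $ a - (A ** B) $ c $ b\<bar>)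
        \<le> (\<Sum>c\<in>UNIV. \<Sum>j\<in>UNIV. (A $ c $ j - ?d) * \<bar>?v j\<bar>)"
      by (rule sum_mono)
    also have "\<dots> = (\<Sum>j\<in>UNIV. (\<Sum>c\<in>UNIV. A $ c $ j - ?d) * \<bar>?v j\<bar>)"
      by (subst sum.swap) (simp only: sum_distrib_right)
    also have "\<dots> = (\<Sum>j\<in>UNIV. (1 - real CARD('k) * ?d) * \<bar>?v j\<bar>)"
      using A by (simp add: sum_subtractf column_stochastic_def)
    finally show ?thesis
      by (simp only: sum_distrib_left)
  qed
  have "column_spread (A ** B) \<le> (\<Sum>a\<in>UNIV. \<Sum>b\<in>UNIV.
      (1 - real CARD('k) * ?d) * (\<Sum>c\<in>UNIV. \<bar>B $ c $ a - B $ c $ b\<bar>))"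
    unfolding column_spread_def by (intro sum_mono *)
  also have "\<dots> = (1 - real CARD('k) * ?d) * column_spread B"
    by (simp only: column_spread_def sum_distrib_left)
  finally show ?thesis .
qed

section \<open>Distance between product distributions\<close>

lemma sum_PiE_insert:
  fixes f :: "('i \<Rightarrow> 'a) \<Rightarrow> real"
  assumes "i \<notin> I"
  shows "(\<Sum>y\<in>insert i I \<rightarrow>\<^sub>E X. f y) = (\<Sum>c\<in>X. \<Sum>y\<in>I \<rightarrow>\<^sub>E X. f (y(i := c)))"
  unfolding PiE_insert_eq sum.cartesian_product
  by (subst sum.reindex[OF inj_combinator[OF assms]]) (simp add: case_prod_unfold)

text \<open>The L1 distance of product distributions is subadditive over coordinates: by induction,
  one factor is exchanged at a time while the remaining factors have total mass 1. With n
  coordinates this is the source of the factor n in the mixing bound.\<close>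

lemma sum_PiE_abs_prod_diff_le:
  fixes p q :: "'i \<Rightarrow> 'a::finite \<Rightarrow> real"
  assumes "finite I"
    and "\<And>i c. i \<in> I \<Longrightarrow> 0 \<le> p i c" "\<And>i. i \<in> I \<Longrightarrow> (\<Sum>c\<in>UNIV. p i c) = 1"
    and "\<And>i c. i \<in> I \<Longrightarrow> 0 \<le> q i c" "\<And>i. i \<in> I \<Longrightarrow> (\<Sum>c\<in>UNIV. q i c) = 1"
  shows "(\<Sum>y\<in>I \<rightarrow>\<^sub>E UNIV. \<bar>(\<Prod>i\<in>I. p i (y i)) - (\<Prod>i\<in>I. q i (y i))\<bar>)
      \<le> (\<Sum>i\<in>I. \<Sum>c\<in>UNIV. \<bar>p i c - q i c\<bar>)"
  using assms
proof (induction I rule: finite_induct)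
  case (insert i I)
  let ?P = "\<lambda>y. \<Prod>i\<in>I. p i (y i)" and ?Q = "\<lambda>y. \<Prod>i\<in>I. q i (y i)"
  let ?E = "I \<rightarrow>\<^sub>E (UNIV :: 'a set)"
  have fin: "finite ?E"
    using insert.hyps by (simp add: finite_PiE)
  have upd: "(\<Prod>j\<in>insert i I. h j ((y(i := c)) j)) = h i c * (\<Prod>j\<in>I. h j (y j))"
    for h :: "'i \<Rightarrow> 'a \<Rightarrow> real" and y c
    using insert.hyps by (simp, intro disjI2 prod.cong) auto
  have P1: "(\<Sum>y\<in>?E. ?P y) = 1"
    using insert by (subst prod_sum_PiE[symmetric]) auto
  have "(\<Sum>y\<in>insert i I \<rightarrow>\<^sub>E UNIV. \<bar>(\<Prod>i\<in>insert i I. p i (y i)) - (\<Prod>i\<in>insert i I. q i (y i))\<bar>)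
      = (\<Sum>c\<in>UNIV. \<Sum>y\<in>?E. \<bar>p i c * ?P y - q i c * ?Q y\<bar>)"
    by (simp only: sum_PiE_insert[OF insert.hyps(2)] upd)
  also have "\<dots> \<le> (\<Sum>c\<in>UNIV. \<Sum>y\<in>?E. \<bar>p i c - q i c\<bar> * ?P y + q i c * \<bar>?P y - ?Q y\<bar>)"
  proof (intro sum_mono)
    \<comment> \<open>Change the factor at \<open>i\<close> first, keeping \<open>?P\<close>, and
      then the remaining ones, keeping \<open>q i c\<close>. Summed over \<open>c\<close> and
      \<open>y\<close>, the kept weights contribute mass 1 in each term.\<close>
    fix c y
    have "p i c * ?P y - q i c * ?Q y = (p i c - q i c) * ?P y + q i c * (?P y - ?Q y)"
      by (simp add: algebra_simps)
    also have "\<bar>\<dots>\<bar> \<le> \<bar>(p i c - q i c) * ?P y\<bar> + \<bar>q i c * (?P y - ?Q y)\<bar>"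
      by (rule abs_triangle_ineq)
    also have "\<dots> = \<bar>p i c - q i c\<bar> * ?P y + q i c * \<bar>?P y - ?Q y\<bar>"
      using insert.prems by (simp add: abs_mult prod_nonneg)
    finally show "\<bar>p i c * ?P y - q i c * ?Q y\<bar>
        \<le> \<bar>p i c - q i c\<bar> * ?P y + q i c * \<bar>?P y - ?Q y\<bar>" .
  qed
  also have "\<dots> = (\<Sum>c\<in>UNIV. \<bar>p i c - q i c\<bar>) * (\<Sum>y\<in>?E. ?P y)
      + (\<Sum>c\<in>UNIV. q i c) * (\<Sum>y\<in>?E. \<bar>?P y - ?Q y\<bar>)"
    by (simp add: sum.distrib sum_product)
  also have "\<dots> \<le> (\<Sum>j\<in>insert i I. \<Sum>c\<in>UNIV. \<bar>p j c - q j c\<bar>)"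
    using insert by (simp add: P1)
  finally show ?case .
qed simp

section \<open>Laws on the finite state space and total variation\<close>

lemma states_nonempty: "(states n :: (nat \<Rightarrow> 'k) set) \<noteq> {}"
  by (simp add: states_def PiE_eq_empty_iff)

lemma sum_pmf_states:
  fixes p :: "(nat \<Rightarrow> 'k::finite) pmf"
  shows "set_pmf p \<subseteq> states n \<Longrightarrow> (\<Sum>x\<in>states n. pmf p x) = 1"
  by (rule sum_pmf_eq_1[OF finite_states])

lemma pmf_outside_states: "set_pmf p \<subseteq> states n \<Longrightarrow> y \<notin> states n \<Longrightarrow> pmf p y = 0"
  by (auto simp: set_pmf_iff)

lemma pmf_bind_states:
  fixes p :: "(nat \<Rightarrow> 'k::finite) pmf"
  assumes "set_pmf p \<subseteq> states n"
  shows "pmf (bind_pmf p K) y = (\<Sum>z\<in>states n. pmf p z * pmf (K z) y)"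
  unfolding pmf_bind
  by (subst integral_measure_pmf[OF finite_states[of n]]) (use assms in auto)

lemma tv_dist_commute: "tv_dist n p q = tv_dist n q p"
  by (simp add: tv_dist_def abs_minus_commute)

lemma tv_dist_triangle: "tv_dist n p r \<le> tv_dist n p q + tv_dist n q r"
proof -
  have "(\<Sum>x\<in>states n. \<bar>pmf p x - pmf r x\<bar>)
      \<le> (\<Sum>x\<in>states n. \<bar>pmf p x - pmf q x\<bar> + \<bar>pmf q x - pmf r x\<bar>)"
    by (intro sum_mono) linarith
  then show ?thesis
    by (simp add: tv_dist_def sum.distrib)
qed

lemma abs_pmf_diff_le_tv_dist:
  fixes p q :: "(nat \<Rightarrow> 'k::finite) pmf"
  assumes "y \<in> states n"
  shows "\<bar>pmf p y - pmf q y\<bar> \<le> 2 * tv_dist n p q"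
  unfolding tv_dist_def
  using member_le_sum[OF assms, of "\<lambda>y. \<bar>pmf p y - pmf q y\<bar>"] by (simp add: finite_states)

text \<open>\<open>bind_pmf p K\<close> is a mixture of the laws \<open>K z\<close>, and total
  variation distance to a fixed law is convex.\<close>

lemma tv_dist_bind_le:
  fixes p q :: "(nat \<Rightarrow> 'k::finite) pmf"
  assumes p: "set_pmf p \<subseteq> states n" and K: "\<And>z. z \<in> states n \<Longrightarrow> tv_dist n (K z) q \<le> e"
  shows "tv_dist n (bind_pmf p K) q \<le> e"
proof -
  have "\<bar>pmf (bind_pmf p K) y - pmf q y\<bar> \<le> (\<Sum>z\<in>states n. pmf p z * \<bar>pmf (K z) y - pmf q y\<bar>)" for y
  proof -
    \<comment> \<open>Since \<open>p\<close> has mass 1 on \<open>states n\<close>,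
      \<open>pmf q y\<close> can be averaged over the same weights and moved inside the sum.\<close>
    have "pmf (bind_pmf p K) y - pmf q y
        = (\<Sum>z\<in>states n. pmf p z * pmf (K z) y) - (\<Sum>z\<in>states n. pmf p z) * pmf q y"
      by (simp add: pmf_bind_states[OF p] sum_pmf_states[OF p])
    also have "\<dots> = (\<Sum>z\<in>states n. pmf p z * (pmf (K z) y - pmf q y))"
      by (simp only: sum_distrib_right sum_subtractf right_diff_distrib)
    also have "\<bar>\<dots>\<bar> \<le> (\<Sum>z\<in>states n. \<bar>pmf p z * (pmf (K z) y - pmf q y)\<bar>)"
      by (rule sum_abs)
    finally show ?thesis
      by (simp add: abs_mult)
  qed
  then have "tv_dist n (bind_pmf p K) q
      \<le> 1/2 * (\<Sum>y\<in>states n. \<Sum>z\<in>states n. pmf p z * \<bar>pmf (K z) y - pmf q y\<bar>)"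
    unfolding tv_dist_def by (intro mult_left_mono sum_mono) auto
  also have "\<dots> = (\<Sum>z\<in>states n. pmf p z * tv_dist n (K z) q)"
    unfolding tv_dist_def by (subst sum.swap) (simp add: sum_distrib_left mult_ac)
  also have "\<dots> \<le> (\<Sum>z\<in>states n. pmf p z * e)"
    by (intro sum_mono mult_left_mono K) auto
  also have "\<dots> = e"
    by (simp only: sum_distrib_right[symmetric] sum_pmf_states[OF p])
  finally show ?thesis .
qed

section \<open>The chain started from a point and from a stationary law\<close>

lemma set_pmf_kernel:
  assumes "paintbox_measure (\<mu> :: (real^'k::finite^'k) measure)"
  shows "set_pmf (kernel \<mu> n x) \<subseteq> states n"
  by (auto simp: set_pmf_iff pmf_kernel[OF assms] split: if_splits)

lemma set_pmf_chain_law: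
  assumes "paintbox_measure (\<mu> :: (real^'k::finite^'k) measure)" "x \<in> states n"
  shows "set_pmf (chain_law \<mu> n x t) \<subseteq> states n"
  using assms(2) set_pmf_kernel[OF assms(1)] by (induction t) auto

text \<open>Chapman-Kolmogorov: conditioning on the state at time \<open>s\<close> shows a later law
  as a mixture of time-\<open>t\<close> laws, the form that \<open>tv_dist_bind_le\<close>
  accepts.\<close>

lemma chain_law_add:
  "chain_law \<mu> n x (s + t) = bind_pmf (chain_law \<mu> n x s) (\<lambda>z. chain_law \<mu> n z t)"
  by (induction t) (simp_all add: bind_return_pmf' bind_assoc_pmf)

lemma stationary_bind_chain_law:
  assumes "stationary \<mu> n \<pi>"
  shows "bind_pmf \<pi> (\<lambda>z. chain_law \<mu> n z t) = \<pi>"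
  using assms
  by (induction t) (simp_all add: bind_return_pmf' bind_assoc_pmf[symmetric] stationary_def)

text \<open>By stationarity \<open>\<pi>\<close> is itself a mixture of the time-\<open>t\<close>
  laws over starting points, so a bound that holds for all pairs of starting points passes to
  \<open>\<pi>\<close>.\<close>

lemma tv_dist_chain_law_stationary:
  fixes \<mu> :: "(real^'k::finite^'k) measure"
  assumes "stationary \<mu> n \<pi>" "x \<in> states n"
    and "\<And>x z. x \<in> states n \<Longrightarrow> z \<in> states n
      \<Longrightarrow> tv_dist n (chain_law \<mu> n x t) (chain_law \<mu> n z t) \<le> e"
  shows "tv_dist n (chain_law \<mu> n x t) \<pi> \<le> e"
proof -
  have "tv_dist n (bind_pmf \<pi> (\<lambda>z. chain_law \<mu> n z t)) (chain_law \<mu> n x t) \<le> e"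
    using assms by (intro tv_dist_bind_le) (auto simp: stationary_def)
  then show ?thesis
    by (simp add: stationary_bind_chain_law[OF assms(1)] tv_dist_commute)
qed

section \<open>Existence and uniqueness of the stationary law\<close>

lemma pmf_of_finite_weights:
  assumes "finite A" "\<And>x. x \<in> A \<Longrightarrow> 0 \<le> f x" "(\<Sum>x\<in>A. f x) = 1"
  obtains p where "\<And>x. pmf p x = (if x \<in> A then f x else 0)"
proof
  let ?f = "\<lambda>x. if x \<in> A then f x else 0"
  show "pmf (embed_pmf ?f) x = ?f x" for x
  proof (rule pmf_embed_pmf)
    have "(\<integral>\<^sup>+x. ennreal (?f x) \<partial>count_space UNIV) = (\<integral>\<^sup>+x. ennreal (f x) \<partial>count_space A)"
      by (subst nn_integral_count_space_indicator)
        (auto intro!: nn_integral_cong simp: indicator_def)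
    also have "\<dots> = 1"
      using assms by (simp add: nn_integral_count_space_finite sum_ennreal)
    finally show "(\<integral>\<^sup>+x. ennreal (?f x) \<partial>count_space UNIV) = 1" .
  qed (use assms in auto)
qed

text \<open>Existence: from one fixed start the laws are Cauchy in time at each state, and their
  limit is invariant because the kernel acts through a finite sum. Uniqueness: two stationary laws
  are both mixtures of the laws at one late time, where all starting points nearly agree.\<close>

lemma ergodic_if_coalescing:
  fixes \<mu> :: "(real^'k::finite^'k) measure"
  assumes \<mu>: "paintbox_measure \<mu>"
    and coal: "\<And>e. 0 < e \<Longrightarrow> \<exists>t. \<forall>x\<in>states n. \<forall>z\<in>states n.
      tv_dist n (chain_law \<mu> n x t) (chain_law \<mu> n z t) \<le> e"
  shows "ergodic \<mu> n"
  unfolding ergodic_def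
proof (rule ex_ex1I)
  obtain x :: "nat \<Rightarrow> 'k" where x: "x \<in> states n"
    using states_nonempty by blast
  let ?p = "\<lambda>t. chain_law \<mu> n x t"
  note supp = set_pmf_chain_law[OF \<mu> x]
  have "Cauchy (\<lambda>t. pmf (?p t) y)" for y
  proof (cases "y \<in> states n")
    case True
    show ?thesis
    proof (rule metric_CauchyI)
      fix e :: real assume "0 < e"
      then obtain t where t: "\<forall>x\<in>states n. \<forall>z\<in>states n.
          tv_dist n (chain_law \<mu> n x t) (chain_law \<mu> n z t) \<le> e / 8"
        using coal[of "e / 8"] by auto
      have near: "tv_dist n (?p s) (?p t) \<le> e / 8" if "t \<le> s" for s
      proof -
        \<comment> \<open>The surplus \<open>s - t\<close> steps are run first, so that what remains
          is a mixture of laws after exactly \<open>t\<close> steps.\<close>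
        have eq: "?p s = bind_pmf (?p (s - t)) (\<lambda>z. chain_law \<mu> n z t)"
          using chain_law_add[of \<mu> n x "s - t" t] that by simp
        show ?thesis
          unfolding eq by (rule tv_dist_bind_le[OF supp]) (rule t[rule_format, OF _ x])
      qed
      show "\<exists>N. \<forall>s\<ge>N. \<forall>r\<ge>N. dist (pmf (?p s) y) (pmf (?p r) y) < e"
      proof (intro exI allI impI)
        fix s r assume "t \<le> s" "t \<le> r"
        have "\<bar>pmf (?p s) y - pmf (?p r) y\<bar> \<le> 2 * tv_dist n (?p s) (?p r)"
          by (rule abs_pmf_diff_le_tv_dist[OF True])
        also have "\<dots> \<le> 2 * (e / 8 + e / 8)"
          using tv_dist_triangle[of n "?p s" "?p r" "?p t"] near[OF \<open>t \<le> s\<close>] near[OF \<open>t \<le> r\<close>]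
          by (simp add: tv_dist_commute[of n "?p t"])
        finally show "dist (pmf (?p s) y) (pmf (?p r) y) < e"
          using \<open>0 < e\<close> by (simp add: dist_real_def)
      qed
    qed
  next
    case False
    then show ?thesis
      by (simp add: pmf_outside_states[OF supp] Cauchy_convergent_iff convergent_const)
  qed
  then have "\<forall>y. \<exists>l. (\<lambda>t. pmf (?p t) y) \<longlonglongrightarrow> l"
    by (auto simp: Cauchy_convergent_iff convergent_def)
  then obtain L where L: "\<And>y. (\<lambda>t. pmf (?p t) y) \<longlonglongrightarrow> L y"
    by metis
  have "(\<lambda>t. \<Sum>y\<in>states n. pmf (?p t) y) \<longlonglongrightarrow> (\<Sum>y\<in>states n. L y)"
    by (intro tendsto_sum L)
  then have L1: "(\<Sum>y\<in>states n. L y) = 1"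
    by (simp add: sum_pmf_states[OF supp] LIMSEQ_const_iff)
  have L0: "0 \<le> L y" for y
    by (rule LIMSEQ_le_const[OF L]) simp
  obtain \<pi> where \<pi>: "\<And>y. pmf \<pi> y = (if y \<in> states n then L y else 0)"
    using pmf_of_finite_weights[OF finite_states L0 L1] by blast
  have supp_\<pi>: "set_pmf \<pi> \<subseteq> states n"
    by (auto simp: set_pmf_iff \<pi> split: if_splits)
  have "bind_pmf \<pi> (kernel \<mu> n) = \<pi>"
  proof (rule pmf_eqI)
    fix y
    \<comment> \<open>The law at time \<open>Suc t\<close> has two limits: the image of
      \<open>\<pi>\<close> under the kernel, by continuity of finite sums, and \<open>L\<close>, as
      a shifted sequence.\<close>
    have "(\<lambda>t. \<Sum>z\<in>states n. pmf (?p t) z * pmf (kernel \<mu> n z) y)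
        \<longlonglongrightarrow> (\<Sum>z\<in>states n. L z * pmf (kernel \<mu> n z) y)"
      by (intro tendsto_intros L)
    then have "(\<lambda>t. pmf (?p (Suc t)) y) \<longlonglongrightarrow> pmf (bind_pmf \<pi> (kernel \<mu> n)) y"
      by (simp add: pmf_bind_states[OF supp] pmf_bind_states[OF supp_\<pi>] \<pi>)
    moreover have "(\<lambda>t. pmf (?p (Suc t)) y) \<longlonglongrightarrow> L y"
      by (rule LIMSEQ_Suc[OF L])
    ultimately have "pmf (bind_pmf \<pi> (kernel \<mu> n)) y = L y"
      by (rule LIMSEQ_unique)
    moreover have "L y = 0" if "y \<notin> states n"
      using L[of y] by (simp add: pmf_outside_states[OF supp that] LIMSEQ_const_iff)
    ultimately show "pmf (bind_pmf \<pi> (kernel \<mu> n)) y = pmf \<pi> y"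
      by (simp add: \<pi>)
  qed
  with supp_\<pi> show "\<exists>\<pi>. stationary \<mu> n \<pi>"
    by (auto simp: stationary_def)
next
  fix \<pi> \<rho> assume st: "stationary \<mu> n \<pi>" "stationary \<mu> n \<rho>"
  have "tv_dist n \<pi> \<rho> \<le> e" if "0 < e" for e
  proof -
    obtain t where t: "\<And>x z. x \<in> states n \<Longrightarrow> z \<in> states n
        \<Longrightarrow> tv_dist n (chain_law \<mu> n x t) (chain_law \<mu> n z t) \<le> e"
      using coal[OF \<open>0 < e\<close>] by blast
    have "tv_dist n (bind_pmf \<pi> (\<lambda>z. chain_law \<mu> n z t)) \<rho> \<le> e"
    proof (rule tv_dist_bind_le)
      show "set_pmf \<pi> \<subseteq> states n"
        using st(1) by (simp add: stationary_def)
      show "tv_dist n (chain_law \<mu> n z t) \<rho> \<le> e" if "z \<in> states n" for z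
        by (rule tv_dist_chain_law_stationary[OF st(2) that t])
    qed
    then show ?thesis
      by (simp add: stationary_bind_chain_law[OF st(1)])
  qed
  then have "tv_dist n \<pi> \<rho> \<le> 0"
    by (rule field_le_epsilon) simp
  show "\<pi> = \<rho>"
  proof (rule pmf_eqI)
    fix y
    show "pmf \<pi> y = pmf \<rho> y"
    proof (cases "y \<in> states n")
      case True
      then show ?thesis
        using abs_pmf_diff_le_tv_dist[OF True, of \<pi> \<rho>] \<open>tv_dist n \<pi> \<rho> \<le> 0\<close> by simp
    next
      case False
      then show ?thesis
        using st pmf_outside_states[of _ n y] by (simp add: stationary_def)
    qed
  qed
qed

section \<open>Measurability and bounds for the matrix functions\<close>

lemma measurable_left_prod:
  fixes X :: "nat \<Rightarrow> 'b \<Rightarrow> real^'k::finite^'k"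
  assumes \<mu>: "paintbox_measure \<mu>"
    and X: "\<And>i. 1 \<le> i \<Longrightarrow> i \<le> t \<Longrightarrow> X i \<in> measurable N \<mu>"
  shows "(\<lambda>\<omega>. left_prod (\<lambda>i. X i \<omega>) t) \<in> borel_measurable N"
  using X
proof (induction t)
  case (Suc t)
  \<comment> \<open>The factors take values in the space of stochastic matrices; they are
    transferred to the full Borel space, on which matrix multiplication is continuous.\<close>
  have "(\<lambda>A. A) \<in> measurable (restrict_space borel {A. column_stochastic A}) (borel :: (real^'k^'k) measure)"
    by (rule measurable_restrict_space1) simp
  also have "measurable (restrict_space borel {A. column_stochastic A}) (borel :: (real^'k^'k) measure)
      = measurable \<mu> borel"
    using \<mu> by (intro measurable_cong_sets) (auto simp: paintbox_measure_def)
  finally have "X (Suc t) \<in> borel_measurable N"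
    using measurable_compose[of "X (Suc t)" N \<mu> "\<lambda>A. A" borel] Suc.prems by simp
  moreover have "(\<lambda>\<omega>. left_prod (\<lambda>i. X i \<omega>) t) \<in> borel_measurable N"
    using Suc by simp
  moreover have "continuous_on UNIV (\<lambda>x. (fst x :: real^'k^'k) ** (snd x :: real^'k^'k))"
    unfolding matrix_matrix_mult_def by (intro continuous_intros)
  ultimately show ?case
    using borel_measurable_continuous_Pair[where H="(**)"] by simp
qed simp

lemma borel_measurable_entry_prod:
  "(entry_prod :: real^'k::finite^'k \<Rightarrow> real) \<in> borel_measurable borel"
  unfolding entry_prod_def by (intro borel_measurable_continuous_onI continuous_intros)

lemma borel_measurable_column_spread:
  "(column_spread :: real^'k::finite^'k \<Rightarrow> real) \<in> borel_measurable borel"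
  unfolding column_spread_def by (intro borel_measurable_continuous_onI continuous_intros)

text \<open>A crude bound: it gives integrability and the initial value of the geometric
  decay.\<close>

lemma column_spread_le:
  fixes A :: "real^'k::finite^'k"
  assumes "column_stochastic A"
  shows "column_spread A \<le> real CARD('k) ^ 3"
proof -
  have *: "0 \<le> A $ a $ b" "A $ a $ b \<le> 1" for a b
    using assms column_stochastic_le_1[OF assms] by (auto simp: column_stochastic_def)
  have "\<bar>A $ c $ a - A $ c $ b\<bar> \<le> 1" for a b c
    using *[of c a] *[of c b] by linarith
  then have "column_spread A \<le> (\<Sum>a\<in>(UNIV::'k set). \<Sum>b\<in>(UNIV::'k set). \<Sum>c\<in>(UNIV::'k set). 1)"
    unfolding column_spread_def by (intro sum_mono)
  then show ?thesis
    by (simp add: power3_eq_cube)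
qed

section \<open>Transitions under a fixed matrix \<open>A\<close>: the entries of its n-fold tensor
  power\<close>

definition move_prob :: "nat \<Rightarrow> (nat \<Rightarrow> 'k) \<Rightarrow> (nat \<Rightarrow> 'k) \<Rightarrow> real^'k^'k \<Rightarrow> real" where
  "move_prob n x y A = (\<Prod>i\<in>{1..n}. A $ y i $ x i)"

lemma borel_measurable_move_prob:
  "(move_prob n x y :: real^'k::finite^'k \<Rightarrow> real) \<in> borel_measurable borel"
  unfolding move_prob_def by (intro borel_measurable_continuous_onI continuous_intros)

lemma abs_move_prob_le_1:
  assumes "column_stochastic (A :: real^'k::finite^'k)"
  shows "\<bar>move_prob n x y A\<bar> \<le> 1"
  using assms column_stochastic_le_1[OF assms]
  by (simp add: move_prob_def column_stochastic_def prod_nonneg prod_le_1)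

lemma move_prob_mat_1:
  assumes "x \<in> states n" "y \<in> states n"
  shows "move_prob n x y (mat 1) = (if y = x then 1 else 0)"
proof (cases "y = x")
  case False
  \<comment> \<open>States are fixed outside \<open>{1..n}\<close>, so distinct ones differ at a
    coordinate inside, where the identity matrix contributes a zero factor.\<close>
  then obtain i where "i \<in> {1..n}" "y i \<noteq> x i"
    using assms unfolding states_def by (metis PiE_ext)
  then have "move_prob n x y (mat 1) = 0"
    unfolding move_prob_def by (intro prod_zero) (auto simp: mat_def)
  with False show ?thesis by simp
qed (simp add: move_prob_def mat_def)

text \<open>Tensor powers are multiplicative: expanding the product over coordinates of sums over
  the inner index yields one sum over intermediate states \<open>z\<close>.\<close>

lemma move_prob_mult:
  "move_prob n x y (A ** B :: real^'k::finite^'k)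
    = (\<Sum>z\<in>states n. move_prob n z y A * move_prob n x z B)"
proof -
  have "move_prob n x y (A ** B) = (\<Prod>i\<in>{1..n}. \<Sum>j\<in>UNIV. A $ y i $ j * B $ j $ x i)"
    by (simp add: move_prob_def matrix_matrix_mult_def)
  also have "\<dots> = (\<Sum>z\<in>states n. \<Prod>i\<in>{1..n}. A $ y i $ z i * B $ z i $ x i)"
    unfolding states_def by (subst prod_sum_PiE) auto
  finally show ?thesis
    by (simp add: move_prob_def prod.distrib)
qed

lemma sum_move_prob_diff_le:
  fixes A :: "real^'k::finite^'k"
  assumes "column_stochastic A"
  shows "(\<Sum>y\<in>states n. \<bar>move_prob n x y A - move_prob n z y A\<bar>) \<le> real n * column_spread A"
proof -
  have "(\<Sum>y\<in>states n. \<bar>move_prob n x y A - move_prob n z y A\<bar>)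
      \<le> (\<Sum>i\<in>{1..n}. \<Sum>c\<in>UNIV. \<bar>A $ c $ x i - A $ c $ z i\<bar>)"
    unfolding move_prob_def states_def
    using assms by (intro sum_PiE_abs_prod_diff_le) (auto simp: column_stochastic_def)
  also have "\<dots> \<le> (\<Sum>i\<in>{1..n}. column_spread A)"
    by (intro sum_mono columns_diff_le_column_spread)
  finally show ?thesis by simp
qed

section \<open>Independent paintbox matrices and their products over blocks of time\<close>

locale iid_paintbox = prob_space M for M :: "'w measure" +
  fixes \<mu> :: "(real^'k::finite^'k) measure" and S :: "nat \<Rightarrow> 'w \<Rightarrow> real^'k^'k"
  assumes paintbox: "paintbox_measure \<mu>"
    and indep: "indep_vars (\<lambda>_. \<mu>) S {1..}"
    and law: "\<And>i. 1 \<le> i \<Longrightarrow> distr M \<mu> (S i) = \<mu>"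
begin

text \<open>The product of the \<open>t\<close> matrices after time \<open>s\<close>, from
  \<open>S (s + 1)\<close> to \<open>S (s + t)\<close>; thus \<open>block 0 t\<close> is
  \<open>Q\<^sub>t\<close>.\<close>

definition block :: "nat \<Rightarrow> nat \<Rightarrow> 'w \<Rightarrow> real^'k^'k" where
  "block s t \<omega> = left_prod (\<lambda>i. S (s + i) \<omega>) t"

lemma block_add: "block 0 (s + t) \<omega> = block s t \<omega> ** block 0 s \<omega>"
  by (simp add: block_def left_prod_add)

lemma measurable_S: "1 \<le> i \<Longrightarrow> S i \<in> measurable M \<mu>"
  using indep by (auto simp: indep_vars_def)

lemma measurable_block: "block s t \<in> borel_measurable M"
  unfolding block_def by (intro measurable_left_prod[OF paintbox] measurable_S) simp

lemma column_stochastic_block: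
  assumes "\<omega> \<in> space M"
  shows "column_stochastic (block s t \<omega>)"
  unfolding block_def
  by (rule column_stochastic_left_prod)
    (use measurable_space[OF measurable_S assms] paintbox_space[OF paintbox] in auto)

text \<open>By independence the matrices of the block have a product measure as joint law; the index
  shift carries it to the product measure on \<open>{1..t}\<close>, which does not involve
  \<open>s\<close>.\<close>

lemma distr_block: "distr M borel (block s t) = distr M borel (block 0 t)"
proof -
  have "distr M borel (block s t) = distr (PiM {1..t} (\<lambda>_. \<mu>)) borel (\<lambda>A. left_prod A t)"
    \<comment> \<open>The characterization of independence by product measures needs a nonempty
      index set; empty blocks are the identity and are treated at the end.\<close>
    if "t \<noteq> 0" for s
  proof -
    let ?I = "{s + 1..s + t}" and ?J = "{1..t}"
    let ?X = "\<lambda>\<omega>. \<lambda>i\<in>?I. S i \<omega>" and ?h = "\<lambda>A. \<lambda>i\<in>?J. A (s + i) :: real^'k^'k"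
    have X: "?X \<in> measurable M (PiM ?I (\<lambda>_. \<mu>))"
      by (intro measurable_restrict measurable_S) simp
    have h: "?h \<in> measurable (PiM ?I (\<lambda>_. \<mu>)) (PiM ?J (\<lambda>_. \<mu>))"
      by (intro measurable_restrict measurable_component_singleton) simp
    have g: "(\<lambda>A. left_prod A t) \<in> measurable (PiM ?J (\<lambda>_. \<mu>)) borel"
      by (intro measurable_left_prod[OF paintbox] measurable_component_singleton) simp
    have "distr M (PiM ?I (\<lambda>_. \<mu>)) ?X = PiM ?I (\<lambda>i. distr M \<mu> (S i))"
      using that
      by (subst indep_vars_iff_distr_eq_PiM'[symmetric])
        (auto intro: measurable_S indep_vars_subset[OF indep])
    also have "\<dots> = PiM ?I (\<lambda>_. \<mu>)"
      by (intro PiM_cong law) auto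
    finally have IX: "distr M (PiM ?I (\<lambda>_. \<mu>)) ?X = PiM ?I (\<lambda>_. \<mu>)" .
    have Ih: "distr (PiM ?I (\<lambda>_. \<mu>)) (PiM ?J (\<lambda>_. \<mu>)) ?h = PiM ?J (\<lambda>_. \<mu>)"
      using paintbox by (intro distr_PiM_reindex) (auto simp: paintbox_measure_def)
    have "distr (PiM ?J (\<lambda>_. \<mu>)) borel (\<lambda>A. left_prod A t)
        = distr (distr (distr M (PiM ?I (\<lambda>_. \<mu>)) ?X) (PiM ?J (\<lambda>_. \<mu>)) ?h) borel (\<lambda>A. left_prod A t)"
      by (simp only: IX Ih)
    also have "\<dots> = distr M borel (\<lambda>\<omega>. left_prod (?h (?X \<omega>)) t)"
      unfolding distr_distr[OF h X] distr_distr[OF g measurable_comp[OF X h]]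
      by (simp only: comp_def)
    also have "\<dots> = distr M borel (block s t)"
      unfolding block_def by (intro distr_cong left_prod_cong) auto
    finally show ?thesis ..
  qed
  moreover have "block s 0 = block 0 0"
    by (simp add: block_def fun_eq_iff)
  ultimately show ?thesis
    by (cases "t = 0") simp_all
qed

text \<open>The two products are measurable functions of the matrices over disjoint index
  sets.\<close>

lemma indep_block: "indep_var borel (block s t) borel (block 0 s)"
proof -
  let ?I = "{s + 1..s + t}" and ?J = "{1..s}"
  have "indep_var borel ((\<lambda>A. left_prod (\<lambda>i. A (s + i)) t) \<circ> (\<lambda>\<omega>. \<lambda>i\<in>?I. S i \<omega>))
      borel ((\<lambda>A. left_prod A s) \<circ> (\<lambda>\<omega>. \<lambda>i\<in>?J. S i \<omega>))"
  proof (rule indep_var_compose)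
    show "indep_var (PiM ?I (\<lambda>_. \<mu>)) (\<lambda>\<omega>. \<lambda>i\<in>?I. S i \<omega>) (PiM ?J (\<lambda>_. \<mu>)) (\<lambda>\<omega>. \<lambda>i\<in>?J. S i \<omega>)"
      by (rule indep_var_restrict[OF indep]) auto
    show "(\<lambda>A. left_prod (\<lambda>i. A (s + i)) t) \<in> measurable (PiM ?I (\<lambda>_. \<mu>)) borel"
      "(\<lambda>A. left_prod A s) \<in> measurable (PiM ?J (\<lambda>_. \<mu>)) borel"
      by (intro measurable_left_prod[OF paintbox] measurable_component_singleton; simp)+
  qed
  moreover have "(\<lambda>A. left_prod (\<lambda>i. A (s + i)) t) \<circ> (\<lambda>\<omega>. \<lambda>i\<in>?I. S i \<omega>) = block s t"
    "(\<lambda>A. left_prod A s) \<circ> (\<lambda>\<omega>. \<lambda>i\<in>?J. S i \<omega>) = block 0 s"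
    unfolding block_def comp_def by (intro ext left_prod_cong; simp)+
  ultimately show ?thesis by simp
qed

context
  fixes f :: "real^'k^'k \<Rightarrow> real" and B :: real
  assumes f_meas: "f \<in> borel_measurable borel"
    and f_bound: "\<And>A. column_stochastic A \<Longrightarrow> \<bar>f A\<bar> \<le> B"
begin

text \<open>A bound for \<open>f\<close> on stochastic matrices suffices, since blocks take no other
  values on \<open>space M\<close>.\<close>

lemma integrable_block: "integrable M (\<lambda>\<omega>. f (block s t \<omega>))"
  by (rule integrable_const_bound[where B=B])
    (auto intro!: AE_I2 f_bound column_stochastic_block measurable_compose[OF measurable_block f_meas])

lemma expectation_block:
  "expectation (\<lambda>\<omega>. f (block s t \<omega>)) = expectation (\<lambda>\<omega>. f (block 0 t \<omega>))"
  using integral_distr[OF measurable_block f_meas, of s t]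
    integral_distr[OF measurable_block f_meas, of 0 t]
  by (simp add: distr_block[of s t])

end

text \<open>Independence factors the expectation; the later block is then moved to time 0, which
  leaves its law unchanged.\<close>

lemma expectation_block_mult:
  fixes f g :: "real^'k^'k \<Rightarrow> real"
  assumes f: "f \<in> borel_measurable borel" "\<And>A. column_stochastic A \<Longrightarrow> \<bar>f A\<bar> \<le> B"
    and g: "g \<in> borel_measurable borel" "\<And>A. column_stochastic A \<Longrightarrow> \<bar>g A\<bar> \<le> C"
  shows "integrable M (\<lambda>\<omega>. f (block s t \<omega>) * g (block 0 s \<omega>))"
    and "expectation (\<lambda>\<omega>. f (block s t \<omega>) * g (block 0 s \<omega>))
      = expectation (\<lambda>\<omega>. f (block 0 t \<omega>)) * expectation (\<lambda>\<omega>. g (block 0 s \<omega>))"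
proof -
  have "indep_var borel (f \<circ> block s t) borel (g \<circ> block 0 s)"
    by (rule indep_var_compose[OF indep_block f(1) g(1)])
  then have *: "indep_var borel (\<lambda>\<omega>. f (block s t \<omega>)) borel (\<lambda>\<omega>. g (block 0 s \<omega>))"
    by (simp add: comp_def)
  note ** = integrable_block[OF f] integrable_block[OF g]
  show "integrable M (\<lambda>\<omega>. f (block s t \<omega>) * g (block 0 s \<omega>))"
    by (rule indep_var_integrable[OF * **])
  show "expectation (\<lambda>\<omega>. f (block s t \<omega>) * g (block 0 s \<omega>))
      = expectation (\<lambda>\<omega>. f (block 0 t \<omega>)) * expectation (\<lambda>\<omega>. g (block 0 s \<omega>))"
    by (simp only: indep_var_lebesgue_integral[OF * **] expectation_block[OF f, of s t])
qed

section \<open>The law of the chain as an average over random matrix products\<close>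

lemma transition_prob_eq_expectation:
  "transition_prob \<mu> n x y = expectation (\<lambda>\<omega>. move_prob n x y (block 0 1 \<omega>))"
proof -
  have "(\<lambda>A. \<Prod>i\<in>{1..n}. A $ y i $ x i) \<in> borel_measurable (distr M \<mu> (S 1))"
    using borel_measurable_integrable[OF integrable_entries[OF paintbox]]
    by (simp add: law del: One_nat_def)
  then have "(\<integral>A. (\<Prod>i\<in>{1..n}. A $ y i $ x i) \<partial>distr M \<mu> (S 1))
      = expectation (\<lambda>\<omega>. \<Prod>i\<in>{1..n}. S 1 \<omega> $ y i $ x i)"
    by (intro integral_distr measurable_S) simp_all
  then show ?thesis
    by (simp add: law transition_prob_def move_prob_def block_def)
qed

text \<open>This links the recursively defined chain to \<open>Q\<^sub>t\<close>. In the induction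
  step the new matrix is independent of the past, so a product of expectations becomes the
  expectation of a product, and multiplicativity of \<open>move_prob\<close> sums out the
  intermediate state.\<close>

lemma pmf_chain_law:
  assumes x: "x \<in> states n" and y: "y \<in> states n"
  shows "pmf (chain_law \<mu> n x t) y = expectation (\<lambda>\<omega>. move_prob n x y (block 0 t \<omega>))"
  using y
proof (induction t arbitrary: y)
  case 0
  then show ?case
    using x by (simp add: block_def move_prob_mat_1 prob_space)
next
  case (Suc t)
  note * = expectation_block_mult[OF borel_measurable_move_prob abs_move_prob_le_1
      borel_measurable_move_prob abs_move_prob_le_1]
  have "pmf (chain_law \<mu> n x (Suc t)) y
      = (\<Sum>z\<in>states n. pmf (chain_law \<mu> n x t) z * transition_prob \<mu> n z y)"
    using Suc.prems
    by (simp add: pmf_bind_states[OF set_pmf_chain_law[OF paintbox x]] pmf_kernel[OF paintbox])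
  \<comment> \<open>The one-step probability is realized by \<open>block t 1\<close>, not
    \<open>block 0 1\<close>: only the former is independent of \<open>block 0 t\<close> and extends
    it to \<open>block 0 (t + 1)\<close>.\<close>
  also have "\<dots> = (\<Sum>z\<in>states n. expectation
      (\<lambda>\<omega>. move_prob n z y (block t 1 \<omega>) * move_prob n x z (block 0 t \<omega>)))"
    by (intro sum.cong refl)
      (simp only: Suc.IH transition_prob_eq_expectation *(2), rule mult.commute)
  also have "\<dots> = expectation (\<lambda>\<omega>. \<Sum>z\<in>states n.
      move_prob n z y (block t 1 \<omega>) * move_prob n x z (block 0 t \<omega>))"
    by (rule Bochner_Integration.integral_sum[symmetric], rule *(1))
  also have "\<dots> = expectation (\<lambda>\<omega>. move_prob n x y (block 0 (t + 1) \<omega>))"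
    by (simp only: move_prob_mult[symmetric] block_add[symmetric])
  finally show ?case by simp
qed

lemma abs_column_spread_le:
  "column_stochastic A \<Longrightarrow> \<bar>column_spread (A :: real^'k^'k)\<bar> \<le> real CARD('k) ^ 3"
  using column_spread_le[of A] by (simp add: column_spread_nonneg)

lemmas integrable_column_spread =
  integrable_block[OF borel_measurable_column_spread abs_column_spread_le]

text \<open>Both chains are averages over the same random matrix, so the absolute value moves inside
  the expectation, where the product bound applies for each outcome. The factor 1/2 in
  \<open>tv_dist\<close> is given away.\<close>

lemma tv_dist_chain_law_le:
  assumes x: "x \<in> states n" and z: "z \<in> states n"
  shows "tv_dist n (chain_law \<mu> n x t) (chain_law \<mu> n z t)
      \<le> real n * expectation (\<lambda>\<omega>. column_spread (block 0 t \<omega>))"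
proof -
  note int = integrable_block[OF borel_measurable_move_prob abs_move_prob_le_1, of n _ _ 0 t]
  have "tv_dist n (chain_law \<mu> n x t) (chain_law \<mu> n z t)
      \<le> (\<Sum>y\<in>states n. \<bar>pmf (chain_law \<mu> n x t) y - pmf (chain_law \<mu> n z t) y\<bar>)"
    by (simp add: tv_dist_def sum_nonneg)
  also have "\<dots> = (\<Sum>y\<in>states n. \<bar>expectation
      (\<lambda>\<omega>. move_prob n x y (block 0 t \<omega>) - move_prob n z y (block 0 t \<omega>))\<bar>)"
    using int by (simp add: pmf_chain_law[OF x] pmf_chain_law[OF z])
  also have "\<dots> \<le> (\<Sum>y\<in>states n. expectation
      (\<lambda>\<omega>. \<bar>move_prob n x y (block 0 t \<omega>) - move_prob n z y (block 0 t \<omega>)\<bar>))"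
    by (intro sum_mono integral_abs_bound)
  also have "\<dots> = expectation (\<lambda>\<omega>. \<Sum>y\<in>states n.
      \<bar>move_prob n x y (block 0 t \<omega>) - move_prob n z y (block 0 t \<omega>)\<bar>)"
    using int by (intro Bochner_Integration.integral_sum[symmetric]) simp
  also have "\<dots> \<le> expectation (\<lambda>\<omega>. real n * column_spread (block 0 t \<omega>))"
    using int integrable_column_spread
    by (intro integral_mono) (auto intro!: sum_move_prob_diff_le column_stochastic_block)
  finally show ?thesis by simp
qed

section \<open>Geometric decay of the expected column spread\<close>

lemma abs_entry_prod_le:
  "column_stochastic A \<Longrightarrow> \<bar>entry_prod (A :: real^'k^'k)\<bar> \<le> 1"
  using entry_prod_le[of A] column_stochastic_le_1[of A] entry_prod_nonneg[of A]
  by (metis abs_of_nonneg order_trans)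

text \<open>The mean contraction factor of \<open>column_spread\<close> over \<open>t\<close> steps;
  it does not involve n.\<close>

definition rate :: "nat \<Rightarrow> real" where
  "rate t = 1 - real CARD('k) * expectation (\<lambda>\<omega>. entry_prod (block 0 t \<omega>))"

text \<open>The contraction holds for each outcome with a random factor determined by the later
  block; independence replaces that factor by its mean.\<close>

lemma expectation_column_spread_add:
  "expectation (\<lambda>\<omega>. column_spread (block 0 (s + t) \<omega>))
    \<le> rate t * expectation (\<lambda>\<omega>. column_spread (block 0 s \<omega>))"
proof -
  let ?f = "\<lambda>A :: real^'k^'k. 1 - real CARD('k) * entry_prod A"
  have f: "?f \<in> borel_measurable borel"
    using borel_measurable_entry_prod by measurable
  have f1: "\<bar>?f A\<bar> \<le> 1" if "column_stochastic A" for A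
    using entry_prod_card_le_1[OF that] entry_prod_nonneg[OF that] by simp
  note * = expectation_block_mult[OF f f1 borel_measurable_column_spread abs_column_spread_le]
  have "expectation (\<lambda>\<omega>. column_spread (block 0 (s + t) \<omega>))
      \<le> expectation (\<lambda>\<omega>. ?f (block s t \<omega>) * column_spread (block 0 s \<omega>))"
    by (intro integral_mono integrable_column_spread *(1))
      (simp_all add: block_add column_spread_mult column_stochastic_block)
  also have "\<dots> = expectation (\<lambda>\<omega>. ?f (block 0 t \<omega>)) * expectation (\<lambda>\<omega>. column_spread (block 0 s \<omega>))"
    by (rule *(2))
  also have "expectation (\<lambda>\<omega>. ?f (block 0 t \<omega>)) = rate t"
    using integrable_block[OF borel_measurable_entry_prod abs_entry_prod_le, of 0 t]
    by (simp add: rate_def prob_space)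
  finally show ?thesis .
qed

text \<open>\<open>entry_prod\<close> is nonnegative on blocks and vanishes exactly when some entry
  does, so mean 0 would force a zero entry almost surely.\<close>

lemma rate_less_1:
  assumes "0 < prob {\<omega> \<in> space M. \<forall>a b. block 0 t \<omega> $ a $ b \<noteq> 0}"
  shows "rate t < 1"
proof -
  note int = integrable_block[OF borel_measurable_entry_prod abs_entry_prod_le, of 0 t]
  have nonneg: "AE \<omega> in M. 0 \<le> entry_prod (block 0 t \<omega>)"
    by (intro AE_I2 entry_prod_nonneg column_stochastic_block)
  have "expectation (\<lambda>\<omega>. entry_prod (block 0 t \<omega>)) \<noteq> 0"
  proof
    assume "expectation (\<lambda>\<omega>. entry_prod (block 0 t \<omega>)) = 0"
    then have "AE \<omega> in M. entry_prod (block 0 t \<omega>) = 0"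
      using integral_nonneg_eq_0_iff_AE[OF int nonneg] by simp
    then have "AE \<omega> in M. \<not> (\<forall>a b. block 0 t \<omega> $ a $ b \<noteq> 0)"
      by eventually_elim (auto simp: entry_prod_def)
    \<comment> \<open>\<open>measure\<close> is 0 on sets outside the sigma-algebra, so positive
      probability already implies measurability.\<close>
    moreover have "{\<omega> \<in> space M. \<forall>a b. block 0 t \<omega> $ a $ b \<noteq> 0} \<in> events"
      using assms measure_notin_sets by force
    ultimately show False
      using assms prob_Collect_eq_0[of "\<lambda>\<omega>. \<forall>a b. block 0 t \<omega> $ a $ b \<noteq> 0"] by simp
  qed
  with integral_nonneg_AE[OF nonneg] show ?thesis
    by (simp add: rate_def less_le)
qed

lemma expectation_column_spread_power:
  assumes "rate t \<le> r" "0 \<le> r"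
  shows "expectation (\<lambda>\<omega>. column_spread (block 0 (t * j) \<omega>)) \<le> r ^ j * real CARD('k) ^ 3"
proof (induction j)
  case 0
  have "column_spread (mat 1 :: real^'k^'k) \<le> real CARD('k) ^ 3"
    by (rule column_spread_le[OF column_stochastic_mat_1])
  then show ?case
    by (simp add: block_def prob_space)
next
  case (Suc j)
  let ?E = "expectation (\<lambda>\<omega>. column_spread (block 0 (t * j) \<omega>))"
  have "expectation (\<lambda>\<omega>. column_spread (block 0 (t * Suc j) \<omega>)) \<le> rate t * ?E"
    using expectation_column_spread_add[of "t * j" t] by (simp add: add.commute)
  also have "\<dots> \<le> r * ?E"
    using assms by (intro mult_right_mono integral_nonneg) (auto simp: column_spread_nonneg)
  also have "\<dots> \<le> r * (r ^ j * real CARD('k) ^ 3)"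
    using Suc.IH assms by (intro mult_left_mono)
  finally show ?case
    by (simp add: mult_ac)
qed

end

section \<open>Mixing and the logarithmic bound\<close>

lemma mixed_at_if_coalesced:
  fixes \<mu> :: "(real^'k::finite^'k) measure"
  assumes "ergodic \<mu> n" "e < \<epsilon>"
    and "\<And>x z. x \<in> states n \<Longrightarrow> z \<in> states n
      \<Longrightarrow> tv_dist n (chain_law \<mu> n x t) (chain_law \<mu> n z t) \<le> e"
  shows "mixed_at \<mu> n \<epsilon> t"
proof -
  have "stationary \<mu> n (stationary_law \<mu> n)"
    using assms(1) unfolding ergodic_def stationary_law_def by (rule theI')
  then have "tv_dist n (chain_law \<mu> n x t) (stationary_law \<mu> n) < \<epsilon>" if "x \<in> states n" for x
    using tv_dist_chain_law_stationary[OF _ that assms(3)] assms(2) by fastforce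
  then show ?thesis
    unfolding mixed_at_def by (subst Max_less_iff) (auto simp: finite_states states_nonempty)
qed

text \<open>Take logarithms; \<open>- ln r\<close> is positive because \<open>r < 1\<close>.\<close>

lemma mult_power_less_if_ln_le:
  fixes r c \<epsilon> :: real
  assumes "0 < r" "r < 1" "0 < c" "0 < \<epsilon>" "ln (c / \<epsilon>) / - ln r < real j"
  shows "c * r ^ j < \<epsilon>"
proof -
  have "ln (c / \<epsilon>) < real j * - ln r"
    using assms by (simp add: field_simps)
  then have "ln (r ^ j) < ln (\<epsilon> / c)"
    using assms by (simp add: ln_realpow ln_div)
  then have "r ^ j < \<epsilon> / c"
    using assms by simp
  then show ?thesis
    using assms by (simp add: field_simps)
qed

theorem theorem1p1:
  fixes \<mu> :: "(real^'k::finite^'k) measure"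
    and M :: "'w measure"
    and S :: "nat \<Rightarrow> 'w \<Rightarrow> real^'k^'k"
  assumes paintbox: "paintbox_measure \<mu>"
    and prob: "prob_space M"
    and indep: "prob_space.indep_vars M (\<lambda>_. \<mu>) S {1..}"
    and law: "\<And>i. 1 \<le> i \<Longrightarrow> distr M \<mu> (S i) = \<mu>"
    and positive: "\<exists>m\<ge>1. 0 < \<P>(\<omega> in M. \<forall>a b. left_prod (\<lambda>i. S i \<omega>) m $ a $ b \<noteq> 0)"
  shows "(\<forall>n\<ge>1. ergodic \<mu> n) \<and>
    (\<forall>\<epsilon>. 0 < \<epsilon> \<and> \<epsilon> < 1 \<longrightarrow>
      (\<forall>n\<ge>1. \<exists>m\<ge>1. mixed_at \<mu> n \<epsilon> m) \<and>
      (\<lambda>n. real (mixing_time \<mu> n \<epsilon>)) \<in> O(\<lambda>n. ln (real n)))"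
proof -
  interpret iid_paintbox M \<mu> S
    using paintbox prob indep law by (simp add: iid_paintbox_def iid_paintbox_axioms_def)
  obtain m where m: "1 \<le> m"
    and pos: "0 < prob {\<omega> \<in> space M. \<forall>a b. block 0 m \<omega> $ a $ b \<noteq> 0}"
    using positive by (auto simp: block_def)
  \<comment> \<open>\<open>rate m\<close> can be 0, for instance when k = 1; the maximum with 1/2
    keeps \<open>ln r\<close> meaningful and the value below 1.\<close>
  define r where "r = max (rate m) (1/2)"
  have r: "0 < r" "r < 1" "rate m \<le> r"
    using rate_less_1[OF pos] by (auto simp: r_def)
  define C where "C = real CARD('k) ^ 3"
  have C: "0 < C"
    by (simp add: C_def)
  have tv: "tv_dist n (chain_law \<mu> n x (m * j)) (chain_law \<mu> n z (m * j)) \<le> real n * C * r ^ j"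
    if "x \<in> states n" "z \<in> states n" for n x z j
  proof -
    have "real n * expectation (\<lambda>\<omega>. column_spread (block 0 (m * j) \<omega>)) \<le> real n * (r ^ j * C)"
      using r unfolding C_def by (intro mult_left_mono expectation_column_spread_power) auto
    then show ?thesis
      using tv_dist_chain_law_le[OF that, of "m * j"] by (simp add: mult_ac)
  qed
  have steps: "real n * C * r ^ j < e" if "n \<ge> 1" "0 < e" "ln (real n * C / e) / - ln r < real j"
    for n j e
    using r C that by (intro mult_power_less_if_ln_le) auto
  have ergodic: "ergodic \<mu> n" if n: "n \<ge> 1" for n
  proof (rule ergodic_if_coalescing[OF paintbox])
    fix e :: real assume e: "0 < e"
    obtain j where "ln (real n * C / e) / - ln r < real j"
      using reals_Archimedean2 by blast
    from steps[OF n e this] show "\<exists>t. \<forall>x\<in>states n. \<forall>z\<in>states n.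
        tv_dist n (chain_law \<mu> n x t) (chain_law \<mu> n z t) \<le> e"
      using tv[of _ n _ j] by (intro exI[of _ "m * j"] ballI) (meson less_imp_le order_trans)
  qed
  show ?thesis
  proof (intro conjI allI impI ergodic)
    fix \<epsilon> :: real assume \<epsilon>: "0 < \<epsilon> \<and> \<epsilon> < 1"
    \<comment> \<open>The floor plus 1 strictly exceeds the threshold in \<open>steps\<close>,
      \<open>nat\<close> sends negative values to 0, and the last \<open>+ 1\<close> ensures
      \<open>m * j n \<ge> 1\<close>, as the mixing time requires.\<close>
    define j where "j n = nat (\<lfloor>ln (real n * C / \<epsilon>) / - ln r\<rfloor> + 1) + 1" for n
    have mixed: "mixed_at \<mu> n \<epsilon> (m * j n)" if n: "n \<ge> 1" for n
    proof (rule mixed_at_if_coalesced[OF ergodic[OF n] _ tv])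
      have "ln (real n * C / \<epsilon>) / - ln r < real (j n)"
        unfolding j_def by linarith
      then show "real n * C * r ^ j n < \<epsilon>"
        using \<epsilon> n by (intro steps) auto
    qed
    have mj: "1 \<le> m * j n" for n
      using m by (simp add: j_def)
    show "\<exists>m\<ge>1. mixed_at \<mu> n \<epsilon> m" if "n \<ge> 1" for n
      using mixed[OF that] mj by blast
    define a where "a = \<bar>ln (C / \<epsilon>)\<bar>"
    \<comment> \<open>\<open>1 + a\<close> absorbs \<open>ln (C / \<epsilon>)\<close> into a
      multiple of \<open>ln n\<close>, the 2 pays for the two additions of 1 in \<open>j\<close>,
      and \<open>m\<close> is the block length.\<close>
    define c where "c = real m * ((1 + a) / - ln r + 2)"
    \<comment> \<open>From n = 3 on, \<open>ln n \<ge> 1\<close>, so additive constants can be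
      absorbed into multiples of \<open>ln n\<close>.\<close>
    have "real (mixing_time \<mu> n \<epsilon>) \<le> c * ln (real n)" if n: "n \<ge> 3" for n
    proof -
      have "exp 1 \<le> real n"
        using exp_le n by linarith
      then have ln1: "1 \<le> ln (real n)"
        using n by (subst ln_ge_iff) auto
      have "ln (real n * C / \<epsilon>) = ln (real n) + ln (C / \<epsilon>)"
        using n C \<epsilon> by (simp add: ln_mult ln_div)
      also have "\<dots> \<le> ln (real n) + a * ln (real n)"
        using mult_left_mono[OF ln1, of a] by (simp add: a_def)
      finally have "ln (real n * C / \<epsilon>) / - ln r \<le> (1 + a) * ln (real n) / - ln r"
        using r by (intro divide_right_mono) (auto simp: algebra_simps)
      \<comment> \<open>Nonnegativity covers the case in which \<open>nat\<close> truncates a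
        negative value to 0.\<close>
      moreover have "0 \<le> (1 + a) * ln (real n) / - ln r"
        using r ln1 by (intro divide_nonneg_nonneg mult_nonneg_nonneg) (auto simp: a_def)
      ultimately have "real (j n) \<le> (1 + a) * ln (real n) / - ln r + 2"
        unfolding j_def by linarith
      also have "\<dots> \<le> ((1 + a) / - ln r + 2) * ln (real n)"
        using ln1 by (simp add: algebra_simps)
      finally have "real m * real (j n) \<le> c * ln (real n)"
        unfolding c_def by (simp only: mult.assoc) (rule mult_left_mono, simp_all)
      moreover have "mixing_time \<mu> n \<epsilon> \<le> m * j n"
        unfolding mixing_time_def using mixed mj n by (intro Least_le) auto
      then have "real (mixing_time \<mu> n \<epsilon>) \<le> real m * real (j n)"
        using of_nat_mono by fastforce
      ultimately show ?thesis
        by linarith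
    qed
    then have "eventually (\<lambda>n. norm (real (mixing_time \<mu> n \<epsilon>)) \<le> c * norm (ln (real n))) at_top"
      by (intro eventually_at_top_linorderI[of 3]) auto
    then show "(\<lambda>n. real (mixing_time \<mu> n \<epsilon>)) \<in> O(\<lambda>n. ln (real n))"
      by (rule bigoI)
  qed
qed

end
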